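(* Let $K\subseteq\mathbb{R}^m$ be a nonempty closed convex set, and let $F:K\to\mathbb{R}^m$ be Lipschitz continuous with constant $L$, i.e., $\|F(x)-F(y)\|\le L\|x-y\|$ for all $x,y\in K$. Assume that VI$(K,F)$ has a Minty solution. Let $0<\alpha<\frac1L$, let $x^0\in K$ be arbitrary, and let the sequences $\{x^k\}_{k=0}^\infty$ and $\{y^k\}_{k=0}^\infty$ be generated by the extra-gradient method: for all $k\ge 0$, $$y^k=\Pi_K[x^k-\alpha F(x^k)],\qquad x^{k+1}=\Pi_K[x^k-\alpha F(y^k)].$$ Then the sequence $\{x^k\}_{k=0}^\infty$ is bounded, and every accumulation point $\hat x$ of $\{x^k\}_{k=0}^\infty$ is a solution to VI$(K,F)$.
   Context: A solution of VI$(K,F)$ is a point $x^*\in K$ such that $\langle F(x^* ),x-x^*\rangle\ge 0$ for all $x\in K$; a Minty solution of VI$(K,F)$ is a point $x^*\in K$ such that $\langle F(x),x-x^*\rangle\ge 0$ for all $x\in K$. $\Pi_K[z]$ denotes the Euclidean projection of $z\in\mathbb{R}^m$ on the nonempty closed convex set $K$, i.e., the unique minimizer of $\|x-z\|^2$ over $x\in K$. *)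

theory Defs
  imports "HOL-Analysis.Analysis"
begin

definition vi_solution :: "'a::real_inner set \<Rightarrow> ('a \<Rightarrow> 'a) \<Rightarrow> 'a \<Rightarrow> bool" where
  "vi_solution K F p \<longleftrightarrow> p \<in> K \<and> (\<forall>x\<in>K. F p \<bullet> (x - p) \<ge> 0)"

definition minty_solution :: "'a::real_inner set \<Rightarrow> ('a \<Rightarrow> 'a) \<Rightarrow> 'a \<Rightarrow> bool" where
  "minty_solution K F p \<longleftrightarrow> p \<in> K \<and> (\<forall>x\<in>K. F x \<bullet> (x - p) \<ge> 0)"

(* The projection onto K is the library's closest_point K, which picks a minimizer of
   the distance to K; the minimizer exists and is unique for K nonempty, closed and convex
   (closest_point_exists, closest_point_unique). *)
definition extragradient ::
  "'a::euclidean_space set \<Rightarrow> ('a \<Rightarrow> 'a) \<Rightarrow> real \<Rightarrow> (nat \<Rightarrow> 'a) \<Rightarrow> (nat \<Rightarrow> 'a) \<Rightarrow> bool" where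
  "extragradient K F \<alpha> x y \<longleftrightarrow>
     (\<forall>k. y k = closest_point K (x k - \<alpha> *\<^sub>R F (x k)) \<and>
          x (Suc k) = closest_point K (x k - \<alpha> *\<^sub>R F (y k)))"

(* Accumulation point of a sequence, not of its range: a value taken infinitely often
   counts, so islimpt on the range would be the wrong notion. *)
definition accumulation_point :: "(nat \<Rightarrow> 'a::topological_space) \<Rightarrow> 'a \<Rightarrow> bool" where
  "accumulation_point x p \<longleftrightarrow> (\<exists>r. strict_mono r \<and> (x \<circ> r) \<longlonglongrightarrow> p)"

end

theory Submission
  imports Defs
begin

text \<open>One extra-gradient step brings the iterate closer to every Minty solution \<open>p\<close>:
  combining the variational characterisations of the two projections with the Minty
  inequality at \<open>y\<^sup>k\<close> yields
  \<open>\<parallel>x\<^sup>k\<^sup>+\<^sup>1 - p\<parallel>\<^sup>2 \<le> \<parallel>x\<^sup>k - p\<parallel>\<^sup>2 - (1 - \<alpha>\<^sup>2L\<^sup>2) \<parallel>x\<^sup>k - y\<^sup>k\<parallel>\<^sup>2\<close>.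
  Hence \<open>x\<close> is bounded and \<open>x\<^sup>k - y\<^sup>k \<rightarrow> 0\<close>, so an accumulation point of \<open>x\<close> is also one of
  \<open>y\<close> along the same indices, and the variational inequality characterising \<open>y\<^sup>k\<close> passes
  to the limit.\<close>

lemma extragradient_step:
  fixes K :: "'a::euclidean_space set"
  assumes K: "closed K" "convex K"
    and F: "L-lipschitz_on K F"
    and p: "minty_solution K F p"
    and "0 < \<alpha>" and "x \<in> K"
    and y: "y = closest_point K (x - \<alpha> *\<^sub>R F x)"
    and z: "z = closest_point K (x - \<alpha> *\<^sub>R F y)"
  shows "(norm (z - p))\<^sup>2 \<le> (norm (x - p))\<^sup>2 - (1 - (\<alpha> * L)\<^sup>2) * (norm (x - y))\<^sup>2"
proof -
  have "K \<noteq> {}" using \<open>x \<in> K\<close> by blast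
  have yK: "y \<in> K" and zK: "z \<in> K"
    using closest_point_in_set[OF K(1) \<open>K \<noteq> {}\<close>] y z by auto
  have pK: "p \<in> K" and minty: "0 \<le> F y \<bullet> (y - p)"
    using p yK by (auto simp: minty_solution_def)
  \<comment> \<open>The projection \<open>y\<close> is tested at \<open>z\<close> and the projection
    \<open>z\<close> at \<open>p\<close>, so that \<open>F x\<close> is paired only with
    \<open>z - y\<close> and the Minty inequality is needed only at \<open>y\<close>.\<close>
  have proj_y: "(x - \<alpha> *\<^sub>R F x - y) \<bullet> (z - y) \<le> 0"
    using closest_point_dot[OF K(2,1) zK] y by blast
  have proj_z: "(x - \<alpha> *\<^sub>R F y - z) \<bullet> (p - z) \<le> 0"
    using closest_point_dot[OF K(2,1) pK] z by blast
  \<comment> \<open>This bounds the price of replacing \<open>F x\<close> by \<open>F y\<close>. The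
    form \<open>2ab \<le> a^2 + b^2\<close> is chosen with \<open>b = norm (z - y)\<close>, whose
    square cancels exactly in the identity below.\<close>
  have "(F x - F y) \<bullet> (z - y) \<le> norm (F x - F y) * norm (z - y)"
    by (rule norm_cauchy_schwarz)
  also have "\<dots> \<le> L * norm (x - y) * norm (z - y)"
    using lipschitz_onD[OF F \<open>x \<in> K\<close> yK] by (intro mult_right_mono) (auto simp: dist_norm)
  finally have "2 * (\<alpha> * ((F x - F y) \<bullet> (z - y))) \<le> 2 * (\<alpha> * (L * norm (x - y) * norm (z - y)))"
    using \<open>0 < \<alpha>\<close> by simp
  also have "\<dots> \<le> (\<alpha> * L)\<^sup>2 * (norm (x - y))\<^sup>2 + (norm (z - y))\<^sup>2"
    using sum_squares_bound[of "\<alpha> * L * norm (x - y)" "norm (z - y)"]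
    by (simp only: power_mult_distrib mult_ac)
  finally have cross: "2 * (\<alpha> * ((F x - F y) \<bullet> (z - y)))
      \<le> (\<alpha> * L)\<^sup>2 * (norm (x - y))\<^sup>2 + (norm (z - y))\<^sup>2" .
  \<comment> \<open>A pure expansion: the terms in \<open>\<alpha>\<close> sum to zero because
    \<open>(p - z) + (z - y) + (y - p) = 0\<close>.\<close>
  have "(norm (z - p))\<^sup>2 = (norm (x - p))\<^sup>2 - (norm (x - y))\<^sup>2 - (norm (z - y))\<^sup>2
      + 2 * ((x - \<alpha> *\<^sub>R F y - z) \<bullet> (p - z)) + 2 * ((x - \<alpha> *\<^sub>R F x - y) \<bullet> (z - y))
      + 2 * (\<alpha> * ((F x - F y) \<bullet> (z - y))) - 2 * (\<alpha> * (F y \<bullet> (y - p)))"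
    unfolding power2_norm_eq_inner by (simp add: inner_diff_left inner_diff_right inner_commute algebra_simps)
  then show ?thesis
    using proj_y proj_z cross mult_nonneg_nonneg[OF less_imp_le[OF \<open>0 < \<alpha>\<close>] minty]
    by (simp add: algebra_simps)
qed

text \<open>The sequence \<open>a\<close> decreases and is bounded below, so it converges and its
  decrements vanish; these dominate \<open>c * b k\<close>.\<close>

lemma tendsto_zero_of_telescoping_bound:
  fixes a b :: "nat \<Rightarrow> real"
  assumes "0 < c" and "\<And>k. 0 \<le> a k" and "\<And>k. 0 \<le> b k"
    and step: "\<And>k. a (Suc k) \<le> a k - c * b k"
  shows "b \<longlonglongrightarrow> 0"
proof -
  have "a (Suc k) \<le> a k" for k
    using step[of k] assms(1) assms(3)[of k] mult_nonneg_nonneg[of c "b k"] by linarith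
  then have "decseq a" by (rule decseq_SucI)
  then obtain l where l: "a \<longlonglongrightarrow> l"
    using decseq_convergent[of a 0] assms(2) by blast
  have "(\<lambda>k. (a k - a (Suc k)) / c) \<longlonglongrightarrow> (l - l) / c"
    using l LIMSEQ_Suc[OF l] \<open>0 < c\<close> by (intro tendsto_intros) auto
  then have lim: "(\<lambda>k. (a k - a (Suc k)) / c) \<longlonglongrightarrow> 0" by simp
  have "b k \<le> (a k - a (Suc k)) / c" for k
    using step[of k] \<open>0 < c\<close> by (simp add: pos_le_divide_eq mult.commute)
  then show ?thesis
    using assms(3) by (intro tendsto_sandwich[OF _ _ tendsto_const lim]) auto
qed

text \<open>Asymptotic version of the fact that fixed points of the projected step solve the
  variational inequality. The sequence \<open>u\<close> is arbitrary so that it can be a subsequence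
  of the iterates.\<close>

lemma vi_solution_of_projection_limit:
  fixes K :: "'a::euclidean_space set"
  assumes K: "closed K" "convex K" and "continuous_on K F" and "0 < \<alpha>"
    and uK: "\<And>k. u k \<in> K" and u: "u \<longlonglongrightarrow> q"
    and diff: "(\<lambda>k. u k - closest_point K (u k - \<alpha> *\<^sub>R F (u k))) \<longlonglongrightarrow> 0"
  shows "vi_solution K F q"
  unfolding vi_solution_def
proof (intro conjI ballI)
  define v where "v k = closest_point K (u k - \<alpha> *\<^sub>R F (u k))" for k
  show qK: "q \<in> K"
    using closed_sequentially[OF K(1) _ u] uK by blast
  have v: "v \<longlonglongrightarrow> q"
    using tendsto_diff[OF u diff] by (simp add: v_def[abs_def])
  have Fu: "(\<lambda>k. F (u k)) \<longlonglongrightarrow> F q"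
    using continuous_on_tendsto_compose[OF assms(3) u qK] uK by simp
  fix z assume "z \<in> K"
  have "(u k - \<alpha> *\<^sub>R F (u k) - v k) \<bullet> (z - v k) \<le> 0" for k
    unfolding v_def by (rule closest_point_dot[OF K(2,1) \<open>z \<in> K\<close>])
  moreover have "(\<lambda>k. (u k - \<alpha> *\<^sub>R F (u k) - v k) \<bullet> (z - v k))
      \<longlonglongrightarrow> (q - \<alpha> *\<^sub>R F q - q) \<bullet> (z - q)"
    by (intro tendsto_intros u v Fu)
  ultimately have "(q - \<alpha> *\<^sub>R F q - q) \<bullet> (z - q) \<le> 0"
    by (intro LIMSEQ_le_const2) auto
  \<comment> \<open>In the limit both copies of \<open>q\<close> cancel and only
    \<open>- \<alpha> *\<^sub>R F q\<close> is left in the first factor.\<close>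
  then show "0 \<le> F q \<bullet> (z - q)"
    using \<open>0 < \<alpha>\<close> by (simp add: zero_le_mult_iff)
qed

theorem theorem8:
  fixes K :: "(real ^ 'm) set"
    and F :: "real ^ 'm \<Rightarrow> real ^ 'm"
    and L \<alpha> :: real
    and x y :: "nat \<Rightarrow> real ^ 'm"
  assumes "K \<noteq> {}" and "closed K" and "convex K"
    and "L-lipschitz_on K F"
    and "\<exists>p. minty_solution K F p"
    and "0 < \<alpha>" and "\<alpha> < 1 / L"
    and "x 0 \<in> K"
    and "extragradient K F \<alpha> x y"
  shows "bounded (range x) \<and> (\<forall>p. accumulation_point x p \<longrightarrow> vi_solution K F p)"
proof -
  obtain p where p: "minty_solution K F p"
    using assms(5) by blast
  \<comment> \<open>\<open>L = 0\<close> is excluded because \<open>1 / 0 = 0\<close>.\<close>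
  have "0 < L"
    using less_trans[OF assms(6,7)] by simp
  then have "\<alpha> * L < 1"
    using assms(7) by (simp add: pos_less_divide_eq)
  then have c: "0 < 1 - (\<alpha> * L)\<^sup>2"
    using \<open>0 < L\<close> assms(6) by (simp add: abs_square_less_1)
  have y: "y k = closest_point K (x k - \<alpha> *\<^sub>R F (x k))"
    and x: "x (Suc k) = closest_point K (x k - \<alpha> *\<^sub>R F (y k))" for k
    using assms(9) by (auto simp: extragradient_def)
  have xK: "x k \<in> K" for k
    using assms(8) closest_point_in_set[OF assms(2,1)] by (cases k) (auto simp: x)
  have step: "(norm (x (Suc k) - p))\<^sup>2
      \<le> (norm (x k - p))\<^sup>2 - (1 - (\<alpha> * L)\<^sup>2) * (norm (x k - y k))\<^sup>2" for k
    by (rule extragradient_step[OF assms(2-4) p assms(6) xK y x])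
  \<comment> \<open>Fejer monotonicity: the iterates never leave the ball around \<open>p\<close>
    through \<open>x 0\<close>.\<close>
  have "(norm (x (Suc k) - p))\<^sup>2 \<le> (norm (x k - p))\<^sup>2" for k
    using step[of k] mult_nonneg_nonneg[OF less_imp_le[OF c] zero_le_power2[of "norm (x k - y k)"]]
    by linarith
  then have "norm (x (Suc k) - p) \<le> norm (x k - p)" for k
    using power2_le_imp_le norm_ge_zero by blast
  then have "norm (x k - p) \<le> norm (x 0 - p)" for k
    using lift_Suc_antimono_le[of "\<lambda>k. norm (x k - p)" 0 k] by simp
  then have "range x \<subseteq> cball p (norm (x 0 - p))"
    by (auto simp: dist_norm norm_minus_commute)
  then have bdd: "bounded (range x)"
    using bounded_subset[OF bounded_cball] by blast
  have "(\<lambda>k. (norm (x k - y k))\<^sup>2) \<longlonglongrightarrow> 0"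
    by (rule tendsto_zero_of_telescoping_bound[where a = "\<lambda>k. (norm (x k - p))\<^sup>2", OF c _ _ step]) auto
  from tendsto_real_sqrt[OF this] have "(\<lambda>k. norm (x k - y k)) \<longlonglongrightarrow> 0"
    by simp
  then have diff: "(\<lambda>k. x k - y k) \<longlonglongrightarrow> 0"
    by (rule tendsto_norm_zero_cancel)
  have "vi_solution K F q" if q: "accumulation_point x q" for q
  proof -
    obtain r where r: "strict_mono r" "(x \<circ> r) \<longlonglongrightarrow> q"
      using q by (auto simp: accumulation_point_def)
    show ?thesis
    proof (rule vi_solution_of_projection_limit[OF assms(2,3) _ assms(6) _ r(2)])
      show "continuous_on K F"
        by (rule lipschitz_on_continuous_on[OF assms(4)])
      \<comment> \<open>By the definition of \<open>y\<close>, this residual is the subsequence of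
        \<open>x k - y k\<close> along \<open>r\<close>.\<close>
      show "(\<lambda>k. (x \<circ> r) k - closest_point K ((x \<circ> r) k - \<alpha> *\<^sub>R F ((x \<circ> r) k))) \<longlonglongrightarrow> 0"
        using LIMSEQ_subseq_LIMSEQ[OF diff r(1)] by (simp add: o_def y)
    qed (simp add: xK)
  qed
  with bdd show ?thesis by blast
qed

end
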